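(* If $X$ is a finite connected $k$-regular graph with $\mu_1(X) \le 0$, then $X$ has at most $2k+2$ vertices.
   Context: $\mu_1(X)$ denotes the second largest eigenvalue (with multiplicity) of the adjacency matrix of $X$. *)

theory Defs
  imports
    "Graph_Theory.Digraph_Component"
    "Jordan_Normal_Form.Char_Poly"
    "HOL-Computational_Algebra.Polynomial"
    "HOL-Library.Multiset"
begin

text \<open>
  A finite simple graph is represented by the locale \<^locale>\<open>graph\<close>: a finite loop-free symmetric
  digraph without parallel arcs.  An undirected edge is a pair of opposite arcs, so the degree of
  a vertex is its out-degree.
\<close>

definition regular_graph :: "nat \<Rightarrow> ('a, 'b) pre_digraph \<Rightarrow> bool" where
  "regular_graph k X \<longleftrightarrow> (\<forall>v \<in> verts X. out_degree X v = k)"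

definition vertex_list :: "('a, 'b) pre_digraph \<Rightarrow> 'a list" where
  "vertex_list X = (SOME vs. distinct vs \<and> set vs = verts X)"

text \<open>
  Rows and columns follow the order chosen in \<^const>\<open>vertex_list\<close>; a different order conjugates
  the matrix by a permutation matrix and leaves its characteristic polynomial unchanged.
\<close>

definition adjacency_matrix :: "('a, 'b) pre_digraph \<Rightarrow> real mat" where
  "adjacency_matrix X =
     (let vs = vertex_list X; n = length vs
      in mat n n (\<lambda>(i, j). if vs ! i \<rightarrow>\<^bsub>X\<^esub> vs ! j then 1 else 0))"

text \<open>
  \<^const>\<open>proots\<close> collects the real roots of the characteristic polynomial with their multiplicities;
  for a symmetric matrix these are all eigenvalues.
\<close>

definition eigenvalues_desc :: "real mat \<Rightarrow> real list" where
  "eigenvalues_desc A = rev (sorted_list_of_multiset (proots (char_poly A)))"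

text \<open>
  The eigenvalues are numbered from 0, so index 1 is the second largest one.  A graph
  with fewer than two vertices has no second eigenvalue, and the value is then unspecified.
\<close>

definition \<mu>\<^sub>1 :: "('a, 'b) pre_digraph \<Rightarrow> real" where
  "\<mu>\<^sub>1 X = eigenvalues_desc (adjacency_matrix X) ! 1"

end

theory Submission
  imports "HOL-Analysis.Function_Topology" Defs
begin

text \<open>
  If \<open>X\<close> has more than one vertex, it has an edge \<open>uv\<close>.  The vector
  \<open>z = n (e\<^sub>u + e\<^sub>v) - 2 \<cdot> 1\<close> is orthogonal to the all-ones vector and satisfies
  \<open>z\<^sup>T A z = 2 n (n - 2 k)\<close>.  So for \<open>n > 2 k\<close> the adjacency matrix has a positive eigenvalue with
  an eigenvector orthogonal to the all-ones vector.  By connectedness this eigenvalue differs from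
  \<open>k\<close>, hence there are two distinct positive eigenvalues and the second largest one is positive.
\<close>

section \<open>Compactness and maximising a quadratic form\<close>

text \<open>Tychonoff's theorem, transferred from \<open>product_topology\<close> to the type-class
  topology on functions.\<close>

lemma compact_Pi_UNIV:
  fixes B :: "'i \<Rightarrow> 'b::topological_space set"
  assumes "\<And>i. compact (B i)"
  shows "compact {x. \<forall>i. x i \<in> B i}"
proof -
  have "compactin (product_topology (\<lambda>_. euclidean) UNIV) (PiE UNIV B)"
    using assms by (subst compactin_PiE) simp
  moreover have "PiE UNIV B = {x. \<forall>i. x i \<in> B i}"
    by (auto simp: PiE_def Pi_def)
  ultimately show ?thesis
    by (simp add: euclidean_product_topology)
qed

text \<open>The unit vectors of coordinate sum zero form a compact set, so the continuous form
  attains its maximum there; homogeneity of degree 2 extends the bound to all vectors of sum zero.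
  The vector \<open>z\<close> only ensures that the set is nonempty.\<close>

lemma exists_max_form_on_sphere:
  fixes a :: "'a \<Rightarrow> 'a \<Rightarrow> real" and z :: "'a \<Rightarrow> real"
  assumes fin: "finite V" and z: "sum z V = 0" "(\<Sum>v\<in>V. (z v)\<^sup>2) \<noteq> 0"
  obtains y where "sum y V = 0" "(\<Sum>v\<in>V. (y v)\<^sup>2) = 1"
    "\<And>x. sum x V = 0 \<Longrightarrow>
       (\<Sum>v\<in>V. x v * (\<Sum>w\<in>V. a v w * x w))
         \<le> (\<Sum>v\<in>V. y v * (\<Sum>w\<in>V. a v w * y w)) * (\<Sum>v\<in>V. (x v)\<^sup>2)"
proof -
  define q where "q x = (\<Sum>v\<in>V. x v * (\<Sum>w\<in>V. a v w * x w))" for x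
  define N where "N x = (\<Sum>v\<in>V. (x v)\<^sup>2)" for x :: "'a \<Rightarrow> real"
  \<comment> \<open>Vectors are functions on the whole type, so coordinates outside \<open>V\<close>
    are pinned to 0 to obtain a product of compact sets.\<close>
  define K where "K = {x::'a \<Rightarrow> real. \<forall>v. x v \<in> (if v \<in> V then {-1..1} else {0})}"
  define S where "S = K \<inter> ({x. sum x V = 0} \<inter> {x. N x = 1})"
  \<comment> \<open>Normalisation that also clears the coordinates off \<open>V\<close>;
    \<open>q\<close> and \<open>N\<close> only see values on \<open>V\<close>.\<close>
  define \<nu> where "\<nu> x = (\<lambda>v. if v \<in> V then x v / sqrt (N x) else 0)" for x
  have N_pos: "N x > 0" if "N x \<noteq> 0" for x
    using that sum_nonneg[of V "\<lambda>v. (x v)\<^sup>2"] unfolding N_def by force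
  have \<nu>: "\<nu> x \<in> S" "q (\<nu> x) = q x / N x" if "sum x V = 0" "N x \<noteq> 0" for x
  proof -
    have pos: "N x > 0" using N_pos that by blast
    have "sum (\<nu> x) V = sum x V / sqrt (N x)"
      unfolding \<nu>_def by (simp add: sum_divide_distrib)
    moreover have N1: "N (\<nu> x) = 1"
    proof -
      have "N (\<nu> x) = (\<Sum>v\<in>V. (\<nu> x v)\<^sup>2)" by (simp only: N_def)
      also have "\<dots> = (\<Sum>v\<in>V. (x v)\<^sup>2 / N x)"
        using pos by (intro sum.cong) (simp_all add: \<nu>_def power_divide)
      also have "\<dots> = N x / N x" unfolding N_def by (rule sum_divide_distrib[symmetric])
      finally show ?thesis using pos by simp
    qed
    moreover have "\<nu> x \<in> K"
    proof -
      have "\<nu> x v \<in> {-1..1}" if "v \<in> V" for v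
      proof -
        have "(\<nu> x v)\<^sup>2 \<le> N (\<nu> x)"
          unfolding N_def using that fin by (intro member_le_sum) auto
        then have "\<bar>\<nu> x v\<bar> \<le> 1" using N1 abs_square_le_1 by auto
        then show ?thesis by (simp add: abs_le_iff)
      qed
      moreover have "\<nu> x v = 0" if "v \<notin> V" for v
        using that by (simp add: \<nu>_def)
      ultimately show ?thesis unfolding K_def by simp
    qed
    ultimately show "\<nu> x \<in> S"
      using that(1) by (simp add: S_def)
    have "q (\<nu> x) = (\<Sum>v\<in>V. x v / sqrt (N x) * ((\<Sum>w\<in>V. a v w * x w) / sqrt (N x)))"
      unfolding q_def \<nu>_def by (simp add: sum_divide_distrib)
    also have "\<dots> = (\<Sum>v\<in>V. x v * (\<Sum>w\<in>V. a v w * x w) / N x)"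
      using pos by (intro sum.cong) (auto simp: field_simps)
    also have "\<dots> = q x / N x" unfolding q_def by (simp add: sum_divide_distrib)
    finally show "q (\<nu> x) = q x / N x" .
  qed
  have "compact K"
    unfolding K_def by (rule compact_Pi_UNIV) auto
  moreover have "closed {x::'a \<Rightarrow> real. sum x V = 0}" "closed {x. N x = 1}"
    unfolding N_def by (intro closed_Collect_eq continuous_intros
        continuous_on_product_coordinates)+
  ultimately have "compact S"
    unfolding S_def by (intro compact_Int_closed closed_Int)
  moreover have "S \<noteq> {}" using \<nu>(1)[of z] z by (auto simp: N_def)
  moreover have "continuous_on S q"
    unfolding q_def by (intro continuous_intros
        continuous_on_subset[OF continuous_on_product_coordinates] subset_UNIV)
  ultimately obtain y where y: "y \<in> S" "\<And>x. x \<in> S \<Longrightarrow> q x \<le> q y"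
    using continuous_attains_sup by metis
  have "q x \<le> q y * N x" if "sum x V = 0" for x
  proof (cases "N x = 0")
    case True
    then have "\<forall>v\<in>V. x v = 0"
      using fin by (simp add: N_def sum_nonneg_eq_0_iff)
    then show ?thesis using True by (simp add: q_def)
  next
    case False
    then have "q x / N x \<le> q y" using \<nu> y that by metis
    then show ?thesis using N_pos[OF False] by (simp add: field_simps)
  qed
  then show thesis
    using that[of y] y(1) unfolding q_def N_def S_def by auto
qed

section \<open>From maximiser to eigenvector\<close>

text \<open>For small positive \<open>t\<close> the linear term dominates the quadratic one. This is
  the first-order condition at a maximum.\<close>

lemma linear_coeff_zero:
  fixes R C :: real
  assumes "R \<ge> 0" and "\<And>t. 2 * t * R + t\<^sup>2 * C \<le> 0"
  shows "R = 0"
proof (rule ccontr)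
  assume "R \<noteq> 0"
  with assms have R: "R > 0" by simp
  \<comment> \<open>With this choice \<open>t * \<bar>C\<bar> = R - t\<close>, hence
    \<open>2 * R + t * C \<ge> R + t > 0\<close>.\<close>
  define t where "t = R / (1 + \<bar>C\<bar>)"
  have t: "t > 0" using R by (simp add: t_def)
  have "t * (2 * R + t * C) \<le> 0"
    using assms(2)[of t] by (simp add: power2_eq_square algebra_simps)
  with t have "2 * R + t * C \<le> 0" by (simp add: mult_le_0_iff)
  moreover have "t * (1 + \<bar>C\<bar>) = R" by (simp add: t_def)
  moreover have "t * C \<ge> - (t * \<bar>C\<bar>)"
    using t by (metis abs_ge_minus_self abs_mult abs_of_pos minus_le_iff)
  ultimately show False using t R by (simp add: algebra_simps)
qed

text \<open>
  Since all rows sum to the same value, the vectors of coordinate sum zero form an invariant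
  subspace, so a maximiser of the Rayleigh quotient on that subspace is an eigenvector.
\<close>

lemma exists_pos_eigenvector:
  fixes a :: "'a \<Rightarrow> 'a \<Rightarrow> real" and z :: "'a \<Rightarrow> real"
  assumes fin: "finite V"
    and sym: "\<And>v w. v \<in> V \<Longrightarrow> w \<in> V \<Longrightarrow> a v w = a w v"
    and rows: "\<And>v. v \<in> V \<Longrightarrow> (\<Sum>w\<in>V. a v w) = d"
    and z: "sum z V = 0" "(\<Sum>v\<in>V. z v * (\<Sum>w\<in>V. a v w * z w)) > 0"
  obtains y c where "c > 0" "sum y V = 0" "\<exists>v\<in>V. y v \<noteq> 0"
    "\<And>v. v \<in> V \<Longrightarrow> (\<Sum>w\<in>V. a v w * y w) = c * y v"
proof -
  define T where "T x v = (\<Sum>w\<in>V. a v w * x w)" for x v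
  have z0: "(\<Sum>v\<in>V. (z v)\<^sup>2) \<noteq> 0"
  proof
    assume "(\<Sum>v\<in>V. (z v)\<^sup>2) = 0"
    then have "\<forall>v\<in>V. z v = 0" using fin by (simp add: sum_nonneg_eq_0_iff)
    then show False using z(2) by simp
  qed
  obtain y where y: "sum y V = 0" "(\<Sum>v\<in>V. (y v)\<^sup>2) = 1"
    and max: "\<And>x. sum x V = 0 \<Longrightarrow>
       (\<Sum>v\<in>V. x v * T x v) \<le> (\<Sum>v\<in>V. y v * T y v) * (\<Sum>v\<in>V. (x v)\<^sup>2)"
    unfolding T_def using exists_max_form_on_sphere[OF fin z(1) z0, of a] by blast
  define c where "c = (\<Sum>v\<in>V. y v * T y v)"
  have "0 < c * (\<Sum>v\<in>V. (z v)\<^sup>2)"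
    using max[OF z(1)] z(2) unfolding c_def T_def by linarith
  then have c: "c > 0"
    using sum_nonneg[of V "\<lambda>v. (z v)\<^sup>2"] by (simp add: zero_less_mult_iff)
  \<comment> \<open>The residual of the eigenvector equation serves as the direction in which
    \<open>y\<close> is perturbed; the aim is \<open>r = 0\<close> on \<open>V\<close>.\<close>
  define r where "r v = T y v - c * y v" for v
  have swap: "(\<Sum>v\<in>V. x v * T x' v) = (\<Sum>v\<in>V. x' v * T x v)" for x x'
  proof -
    have "(\<Sum>v\<in>V. x v * T x' v) = (\<Sum>v\<in>V. \<Sum>w\<in>V. x v * a v w * x' w)"
      by (simp add: T_def sum_distrib_left mult.assoc)
    also have "\<dots> = (\<Sum>w\<in>V. \<Sum>v\<in>V. x v * a v w * x' w)" by (rule sum.swap)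
    also have "\<dots> = (\<Sum>v\<in>V. x' v * T x v)"
      unfolding T_def sum_distrib_left by (intro sum.cong refl) (simp add: sym)
    finally show ?thesis .
  qed
  \<comment> \<open>Self-adjointness moves \<open>T\<close> onto the all-ones vector, where it acts
    as multiplication by \<open>d\<close>. Hence \<open>r\<close> also has sum zero and is an
    admissible direction.\<close>
  have "sum (T y) V = (\<Sum>v\<in>V. y v * T (\<lambda>_. 1) v)"
    using swap[of "\<lambda>_. 1" y] by simp
  also have "\<dots> = (\<Sum>v\<in>V. y v * d)"
    by (intro sum.cong) (auto simp: T_def rows)
  finally have "sum (T y) V = 0" using y(1) by (simp flip: sum_distrib_right)
  then have r0: "sum r V = 0"
    using y(1) by (simp add: r_def sum_subtractf flip: sum_distrib_left)
  define C where "C = (\<Sum>v\<in>V. r v * T r v) - c * (\<Sum>v\<in>V. (r v)\<^sup>2)"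
  have "(\<Sum>v\<in>V. (r v)\<^sup>2) = 0"
  proof (rule linear_coeff_zero)
    show "(\<Sum>v\<in>V. (r v)\<^sup>2) \<ge> 0" by (simp add: sum_nonneg)
    fix t :: real
    let ?x = "\<lambda>v. y v + t * r v"
    have Tx: "T ?x v = T y v + t * T r v" for v
      unfolding T_def by (simp add: algebra_simps sum.distrib sum_distrib_left)
    have "(\<Sum>v\<in>V. ?x v * T ?x v) = c + t * (\<Sum>v\<in>V. r v * T y v)
        + t * (\<Sum>v\<in>V. y v * T r v) + t\<^sup>2 * (\<Sum>v\<in>V. r v * T r v)"
      unfolding Tx c_def
      by (simp add: algebra_simps sum.distrib sum_distrib_left power2_eq_square)
    then have 1: "(\<Sum>v\<in>V. ?x v * T ?x v)
        = c + 2 * t * (\<Sum>v\<in>V. r v * T y v) + t\<^sup>2 * (\<Sum>v\<in>V. r v * T r v)"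
      using swap[of y r] by simp
    have 2: "(\<Sum>v\<in>V. (?x v)\<^sup>2) = 1 + 2 * t * (\<Sum>v\<in>V. r v * y v) + t\<^sup>2 * (\<Sum>v\<in>V. (r v)\<^sup>2)"
      unfolding y(2)[symmetric]
      by (simp add: algebra_simps sum.distrib sum_distrib_left power2_eq_square)
    \<comment> \<open>This identifies the first variation of the form minus \<open>c\<close> times
      the squared norm, in direction \<open>r\<close>, as twice the squared norm of
      \<open>r\<close>.\<close>
    have 3: "(\<Sum>v\<in>V. (r v)\<^sup>2) = (\<Sum>v\<in>V. r v * T y v) - c * (\<Sum>v\<in>V. r v * y v)"
    proof -
      have "(\<Sum>v\<in>V. (r v)\<^sup>2) = (\<Sum>v\<in>V. r v * T y v - c * (r v * y v))"
        by (simp add: r_def algebra_simps power2_eq_square)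
      then show ?thesis by (simp add: sum_subtractf flip: sum_distrib_left)
    qed
    have "sum ?x V = 0" using y(1) r0 by (simp add: sum.distrib flip: sum_distrib_left)
    from max[OF this, folded c_def] show "2 * t * (\<Sum>v\<in>V. (r v)\<^sup>2) + t\<^sup>2 * C \<le> 0"
      unfolding 1 2 C_def by (subst 3) (simp add: algebra_simps)
  qed
  then have "\<forall>v\<in>V. r v = 0" using fin by (simp add: sum_nonneg_eq_0_iff)
  moreover have "\<exists>v\<in>V. y v \<noteq> 0" using y(2) by (metis (no_types, lifting) sum.neutral zero_neq_one zero_power2)
  ultimately show thesis
    using that[of c y] c y(1) by (auto simp: r_def T_def)
qed

section \<open>Degrees and eigenvectors of a regular graph\<close>

text \<open>Without parallel arcs, \<open>head\<close> is a bijection from the arcs leaving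
  \<open>u\<close> to its out-neighbours.\<close>

lemma sum_adj_eq_out_degree:
  assumes "digraph X" "u \<in> verts X"
  shows "(\<Sum>w\<in>verts X. if u \<rightarrow>\<^bsub>X\<^esub> w then 1 else 0 :: real) = real (out_degree X u)"
proof -
  interpret digraph X by fact
  have "bij_betw (head X) (out_arcs X u) {w \<in> verts X. u \<rightarrow>\<^bsub>X\<^esub> w}"
  proof (rule bij_betwI')
    fix e e' assume "e \<in> out_arcs X u" "e' \<in> out_arcs X u"
    then show "head X e = head X e' \<longleftrightarrow> e = e'"
      using no_multi_arcs by (auto simp: arc_to_ends_def)
  qed (auto simp: arcs_ends_conv)
  then have "card {w \<in> verts X. u \<rightarrow>\<^bsub>X\<^esub> w} = out_degree X u"
    by (simp add: out_degree_def bij_betw_same_card)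
  moreover have "(\<Sum>w\<in>verts X. if u \<rightarrow>\<^bsub>X\<^esub> w then 1 else 0 :: real)
      = real (card {w \<in> verts X. u \<rightarrow>\<^bsub>X\<^esub> w})"
    by (simp flip: sum.inter_filter)
  ultimately show ?thesis by simp
qed

text \<open>The maximum principle: a maximum of an eigenvector for the degree spreads along arcs.\<close>

lemma degree_eigenvector_constant:
  fixes f :: "'a \<Rightarrow> real"
  assumes "digraph X" "strongly_connected X" "regular_graph k X"
    and eig: "\<And>v. v \<in> verts X \<Longrightarrow>
      (\<Sum>w\<in>verts X. (if v \<rightarrow>\<^bsub>X\<^esub> w then 1 else 0) * f w) = real k * f v"
  shows "\<exists>M. \<forall>v\<in>verts X. f v = M"
proof -
  interpret digraph X by fact
  define M where "M = Max (f ` verts X)"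
  have ne: "verts X \<noteq> {}" using assms(2) by (auto simp: strongly_connected_def)
  then obtain u where u: "u \<in> verts X" "f u = M"
    unfolding M_def by (metis (mono_tags, lifting) Max_in finite_imageI finite_verts image_iff image_is_empty)
  have le: "f v \<le> M" if "v \<in> verts X" for v
    unfolding M_def using that by simp
  have "f v = M" if "u \<rightarrow>\<^sup>*\<^bsub>X\<^esub> v" for v
    using that
  proof (induction rule: reachable_induct)
    case base
    show ?case by (rule u)
  next
    case (step x y)
    have xy: "x \<in> verts X" "y \<in> verts X" using step(2) by (auto simp: adj_in_verts)
    \<comment> \<open>As \<open>f x = M\<close>, the nonnegative gaps \<open>M - f w\<close> over
      the \<open>k\<close> out-neighbours of \<open>x\<close> add up to
      \<open>k * M - k * M\<close>, so each of them vanishes.\<close>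
    have "(\<Sum>w\<in>verts X. (if x \<rightarrow>\<^bsub>X\<^esub> w then 1 else 0) * (M - f w))
        = M * (\<Sum>w\<in>verts X. if x \<rightarrow>\<^bsub>X\<^esub> w then 1 else 0) - real k * f x"
      unfolding eig[OF xy(1), symmetric]
      by (simp add: algebra_simps sum_subtractf sum_distrib_left)
    also have "\<dots> = 0"
      using xy step(3) assms(3)
      by (simp add: sum_adj_eq_out_degree[OF assms(1)] regular_graph_def)
    finally have "\<forall>w\<in>verts X. (if x \<rightarrow>\<^bsub>X\<^esub> w then 1 else 0) * (M - f w) = 0"
      using le by (subst (asm) sum_nonneg_eq_0_iff) auto
    then show ?case using step(2) xy by force
  qed
  then show ?thesis using assms(2) u(1) by (auto simp: strongly_connected_def)
qed

section \<open>Matrix eigenvalues and their order\<close>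

text \<open>Bridge from functions on vertices to matrices: reading \<open>f\<close> along
  \<open>vertex_list\<close> gives an eigenvector in coordinates.\<close>

lemma adjacency_matrix_root_char_poly:
  fixes f :: "'a \<Rightarrow> real"
  assumes fin: "finite (verts X)"
    and ne: "\<exists>v\<in>verts X. f v \<noteq> 0"
    and eig: "\<And>v. v \<in> verts X \<Longrightarrow>
      (\<Sum>w\<in>verts X. (if v \<rightarrow>\<^bsub>X\<^esub> w then 1 else 0) * f w) = c * f v"
  shows "poly (char_poly (adjacency_matrix X)) c = 0"
proof -
  define vs where "vs = vertex_list X"
  define n where "n = length vs"
  have vs: "distinct vs" "set vs = verts X"
    using someI_ex[of "\<lambda>vs. distinct vs \<and> set vs = verts X"] finite_distinct_list[OF fin]
    unfolding vs_def vertex_list_def by blast+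
  have A: "adjacency_matrix X = mat n n (\<lambda>(i, j). if vs ! i \<rightarrow>\<^bsub>X\<^esub> vs ! j then 1 else 0)"
    unfolding adjacency_matrix_def Let_def vs_def n_def ..
  have carrier: "adjacency_matrix X \<in> carrier_mat n n" unfolding A by simp
  define x where "x = vec n (\<lambda>i. f (vs ! i))"
  have sum_vs: "(\<Sum>j<n. g (vs ! j)) = sum g (verts X)" for g :: "'a \<Rightarrow> real"
    using bij_betw_nth[OF vs(1) _ vs(2)[symmetric], of "{..<n}"]
    by (simp add: n_def sum.reindex_bij_betw)
  have "adjacency_matrix X *\<^sub>v x = c \<cdot>\<^sub>v x"
  proof (rule eq_vecI)
    fix i assume "i < dim_vec (c \<cdot>\<^sub>v x)"
    then have i: "i < n" by (simp add: x_def)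
    then have "vs ! i \<in> verts X" using vs n_def by auto
    then show "(adjacency_matrix X *\<^sub>v x) $ i = (c \<cdot>\<^sub>v x) $ i"
      using i eig sum_vs[of "\<lambda>w. (if vs ! i \<rightarrow>\<^bsub>X\<^esub> w then 1 else 0) * f w"]
      by (simp add: A x_def scalar_prod_def atLeast0LessThan)
  qed (simp add: A x_def)
  moreover have "x \<noteq> 0\<^sub>v n"
  proof
    assume x0: "x = 0\<^sub>v n"
    obtain i where "i < n" "f (vs ! i) \<noteq> 0"
      using ne vs(2) unfolding n_def by (metis in_set_conv_nth)
    then have "x $ i \<noteq> 0" by (simp add: x_def)
    then show False using x0 \<open>i < n\<close> by simp
  qed
  ultimately have "eigenvector (adjacency_matrix X) x c"
    using carrier by (simp add: eigenvector_def x_def)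
  then show ?thesis
    using eigenvalue_root_char_poly[OF carrier] by (auto simp: eigenvalue_def)
qed

text \<open>The larger \<open>b\<close> stands strictly after \<open>a\<close>, so \<open>a\<close>
  has index at most \<open>length xs - 2\<close>, which is index 1 of the reversed list.\<close>

lemma sorted_rev_nth_1_ge:
  fixes xs :: "'b::linorder list"
  assumes "sorted xs" "a \<in> set xs" "b \<in> set xs" "a < b"
  shows "a \<le> rev xs ! 1"
proof -
  obtain i j where ij: "i < length xs" "xs ! i = a" "j < length xs" "xs ! j = b"
    using assms by (metis in_set_conv_nth)
  have "i < j" using assms(1,4) ij by (metis leD leI sorted_nth_mono)
  then have "a \<le> xs ! (length xs - 2)"
    using ij sorted_nth_mono[OF assms(1), of i "length xs - 2"] by simp
  moreover have "rev xs ! 1 = xs ! (length xs - 2)"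
    using ij \<open>i < j\<close> by (subst rev_nth) (auto simp: numeral_2_eq_2)
  ultimately show ?thesis by simp
qed

lemma eigenvalues_desc_1_pos:
  assumes A: "A \<in> carrier_mat n n"
    and roots: "poly (char_poly A) a = 0" "poly (char_poly A) b = 0"
    and pos: "0 < a" "0 < b" and "a \<noteq> b"
  shows "eigenvalues_desc A ! 1 > 0"
proof -
  \<comment> \<open>Roots are listed by \<open>proots\<close> only for a nonzero polynomial; here it
    is monic.\<close>
  have "char_poly A \<noteq> 0" using degree_monic_char_poly[OF A] by auto
  then have "a \<in> set (sorted_list_of_multiset (proots (char_poly A)))"
    "b \<in> set (sorted_list_of_multiset (proots (char_poly A)))"
    using roots by simp_all
  then have "min a b \<le> eigenvalues_desc A ! 1"
    unfolding eigenvalues_desc_def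
    using sorted_rev_nth_1_ge[OF sorted_sorted_list_of_multiset] \<open>a \<noteq> b\<close>
    by (metis linorder_neqE_linordered_idom min.strict_order_iff min.commute)
  then show ?thesis using pos by (simp add: min_def split: if_splits)
qed

section \<open>The test vector of an edge\<close>

theorem theorem4p3:
  fixes X :: "('a, 'b) pre_digraph" and k :: nat
  assumes "graph X"
    and "connected X"
    and "regular_graph k X"
    and "\<mu>\<^sub>1 X \<le> 0"
  shows "card (verts X) \<le> 2 * k + 2"
proof (rule ccontr)
  assume "\<not> ?thesis"
  then have big: "card (verts X) > 2 * k + 2" by simp
  interpret graph X by fact
  have dg: "digraph X" by unfold_locales
  have sc: "strongly_connected X"
    using assms(2) sym_arcs by (rule symmetric_connected_imp_strongly_connected[rotated])
  define V where "V = verts X"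
  define n where "n = card V"
  define a where "a v w = (if v \<rightarrow>\<^bsub>X\<^esub> w then 1 else 0 :: real)" for v w
  have fin: "finite V" by (simp add: V_def)
  have sym: "a v w = a w v" for v w
    using sym_arcs unfolding a_def by (auto simp: symmetric_def sym_def)
  have rows: "(\<Sum>w\<in>V. a v w) = real k" if "v \<in> V" for v
    using that assms(3) sum_adj_eq_out_degree[OF dg]
    by (simp add: a_def V_def regular_graph_def)
  have loop: "a v v = 0" for v
    using no_loops unfolding a_def arcs_ends_conv by auto
  \<comment> \<open>The first arc on a path between two distinct vertices.\<close>
  obtain u v where uv: "u \<in> V" "v \<in> V" "u \<rightarrow>\<^bsub>X\<^esub> v" "u \<noteq> v"
  proof -
    have "\<not> V \<subseteq> {x}" for x
      using big card_mono[of "{x}" V] by (auto simp: V_def)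
    then obtain x y where xy: "x \<in> V" "y \<in> V" "x \<noteq> y" by blast
    then have "x \<rightarrow>\<^sup>*\<^bsub>X\<^esub> y" using sc by (auto simp: strongly_connected_def V_def)
    then obtain w where w: "x \<rightarrow>\<^bsub>X\<^esub> w" using xy(3) by (cases rule: converse_reachable_cases) auto
    then have "w \<in> V" by (simp add: V_def adj_in_verts)
    moreover have "x \<noteq> w" using w loop[of x] by (auto simp: a_def)
    ultimately show thesis using that xy w by blast
  qed
  \<comment> \<open>The shift by 2 cancels the total \<open>2 * n\<close> of the two peaks.\<close>
  define z where "z w = real n * (of_bool (w = u) + of_bool (w = v)) - 2" for w
  have sum_delta: "(\<Sum>w\<in>V. g w * (of_bool (w = u) + of_bool (w = v))) = g u + g v"
    for g :: "'a \<Rightarrow> real"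
    using uv fin by (simp add: distrib_left sum.distrib of_bool_def if_distrib[of "(*) _"] cong: if_cong)
  have z0: "sum z V = 0"
    using sum_delta[of "\<lambda>_. real n"] by (simp add: z_def sum_subtractf n_def)
  have Tz: "(\<Sum>w\<in>V. a x w * z w) = real n * (a x u + a x v) - 2 * real k" if "x \<in> V" for x
  proof -
    have "(\<Sum>w\<in>V. a x w * z w) = (\<Sum>w\<in>V. real n * a x w * (of_bool (w = u) + of_bool (w = v)))
        - 2 * (\<Sum>w\<in>V. a x w)"
      by (simp add: z_def algebra_simps sum_subtractf sum_distrib_left)
    then show ?thesis using that by (simp only: sum_delta rows) (simp add: algebra_simps)
  qed
  have "(\<Sum>x\<in>V. z x * (\<Sum>w\<in>V. a x w * z w))
      = (\<Sum>x\<in>V. z x * (real n * (a x u + a x v) - 2 * real k))"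
    by (intro sum.cong) (auto simp: Tz)
  also have "\<dots> = real n * ((\<Sum>x\<in>V. a u x * z x) + (\<Sum>x\<in>V. a v x * z x)) - 2 * real k * sum z V"
  proof -
    have "z x * (real n * (a x u + a x v) - 2 * real k)
        = real n * (a u x * z x + a v x * z x) - 2 * real k * z x" for x
      by (simp add: sym[of x u] sym[of x v] algebra_simps)
    then show ?thesis
      by (simp add: sum_subtractf sum.distrib flip: sum_distrib_left)
  qed
  \<comment> \<open>Both \<open>(A z)(u)\<close> and \<open>(A z)(v)\<close> equal
    \<open>n - 2 k\<close>: each endpoint sees the other once and itself not at all.\<close>
  also have "\<dots> = real n * (2 * (real n - 2 * real k))"
  proof -
    have "a u v = 1" "a v u = 1" using uv(3) sym[of u v] by (simp_all add: a_def)
    then show ?thesis using z0 uv by (simp add: Tz loop)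
  qed
  also have "\<dots> > 0" using big by (simp add: n_def V_def)
  finally have qz: "(\<Sum>x\<in>V. z x * (\<Sum>w\<in>V. a x w * z w)) > 0" .
  obtain y c where y: "c > 0" "sum y V = 0" "\<exists>v\<in>V. y v \<noteq> 0"
    "\<And>v. v \<in> V \<Longrightarrow> (\<Sum>w\<in>V. a v w * y w) = c * y v"
    by (rule exists_pos_eigenvector[of V a "real k" z])
      (rule fin sym rows z0 qz that; assumption)+
  \<comment> \<open>An eigenvector for \<open>k\<close> is constant, and a constant of sum zero
    vanishes, unlike \<open>y\<close>.\<close>
  have "c \<noteq> real k"
  proof
    assume "c = real k"
    then obtain M where M: "\<forall>v\<in>V. y v = M"
      using degree_eigenvector_constant[OF dg sc assms(3), of y] y(4)
      unfolding a_def V_def by blast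
    then have "real n * M = 0" using y(2) by (simp add: n_def)
    then show False using M y(3) big by (auto simp: n_def V_def)
  qed
  moreover have "poly (char_poly (adjacency_matrix X)) c = 0"
    using adjacency_matrix_root_char_poly[of X y c] y fin unfolding a_def V_def by blast
  \<comment> \<open>The second eigenvalue comes from the all-ones vector; it is positive because row
    \<open>u\<close> has an entry 1 at \<open>v\<close>.\<close>
  moreover have "poly (char_poly (adjacency_matrix X)) (real k) = 0"
    using adjacency_matrix_root_char_poly[of X "\<lambda>_. 1" "real k"] uv(1) fin rows
    unfolding a_def V_def by auto
  moreover have "real k > 0"
  proof -
    have "a u v \<le> (\<Sum>w\<in>V. a u w)" using uv fin by (intro member_le_sum) (auto simp: a_def)
    then show ?thesis using uv rows by (simp add: a_def)
  qed
  moreover have "\<exists>n. adjacency_matrix X \<in> carrier_mat n n"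
    unfolding adjacency_matrix_def Let_def using mat_carrier by blast
  ultimately have "\<mu>\<^sub>1 X > 0"
    unfolding \<mu>\<^sub>1_def using eigenvalues_desc_1_pos y(1) by blast
  with assms(4) show False by simp
qed

end
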